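(* Let $n,m,k\ge2$ be integers with $n\ge(m+1)k$ and $p=m+1$ prime. Then the generalized Kneser graph satisfies $$\chi(\mathrm{KN}(n,k,m))\ge\frac{\frac np-k}{p(p-1)}.$$
   Context: The generalized Kneser graph $\mathrm{KN}(n,k,m)$ has vertex set all ordered $m$-tuples $(A_1,\dots,A_m)$ of pairwise disjoint $k$-element subsets of $[n]$. Two vertices $\mathcal A=(A_1,\dots,A_m)$, $\mathcal B=(B_1,\dots,B_m)$ are adjacent iff either (A1) $\big(\bigcup_{\ell=1}^iA_\ell\big)\cap\big(\bigcup_{\ell=i}^mB_\ell\big)=\varnothing$ for all $i\in[m]$, or (A2) $\big(\bigcup_{\ell=1}^iB_\ell\big)\cap\big(\bigcup_{\ell=i}^mA_\ell\big)=\varnothing$ for all $i\in[m]$. *)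

theory Defs
  imports Complex_Main "HOL-Computational_Algebra.Primes"
begin

definition KN_vertices :: "nat \<Rightarrow> nat \<Rightarrow> nat \<Rightarrow> nat set list set" where
  "KN_vertices n k m = {As. length As = m \<and>
      (\<forall>i<m. As ! i \<subseteq> {1..n} \<and> card (As ! i) = k) \<and>
      (\<forall>i<m. \<forall>j<m. i \<noteq> j \<longrightarrow> As ! i \<inter> As ! j = {})}"

definition KN_cond :: "nat \<Rightarrow> nat set list \<Rightarrow> nat set list \<Rightarrow> bool" where
  "KN_cond m As Bs = (\<forall>i<m. (\<Union>l\<in>{0..i}. As ! l) \<inter> (\<Union>l\<in>{i..<m}. Bs ! l) = {})"

definition KN_adj :: "nat \<Rightarrow> nat set list \<Rightarrow> nat set list \<Rightarrow> bool" where
  "KN_adj m As Bs = (KN_cond m As Bs \<or> KN_cond m Bs As)"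

definition proper_coloring :: "'a set \<Rightarrow> ('a \<Rightarrow> 'a \<Rightarrow> bool) \<Rightarrow> nat \<Rightarrow> ('a \<Rightarrow> nat) \<Rightarrow> bool" where
  "proper_coloring V E c f = ((\<forall>v\<in>V. f v < c) \<and>
      (\<forall>u\<in>V. \<forall>v\<in>V. E u v \<longrightarrow> f u \<noteq> f v))"

definition chromatic_number :: "'a set \<Rightarrow> ('a \<Rightarrow> 'a \<Rightarrow> bool) \<Rightarrow> nat" where
  "chromatic_number V E = (LEAST c. \<exists>f. proper_coloring V E c f)"

end

theory Submission
  imports Defs "HOL-Number_Theory.Cong"
begin

text \<open>Label a nonzero vector in
  \<open>(Z\<^sub>p \<union> {0})\<^sup>n\<close>, viewed as a partial partition of \<open>{1..n}\<close> into \<open>p\<close> parts, by its size if all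
  parts have fewer than \<open>k\<close> elements, by the set of its large parts if that set is nonempty and
  proper, and otherwise by the first colour \<open>h\<close> occurring on vertices made from \<open>p - 1\<close> cyclically
  consecutive parts, together with the set of parts at which such a vertex of colour \<open>h\<close> may start.
  Since consecutive starting parts give adjacent vertices, the latter set is proper too, so it
  has a well-defined mean in \<open>Z\<^sub>p\<close>. This uses \<open>pk - 1 + (p - 1)c\<close> slots for \<open>c\<close> colours, and
  the lemma shows that at least \<open>n\<close> slots are needed, which is stronger than the claim.

  The Tucker lemma follows from a Lefschetz-type count. A labelling with \<open>N < n\<close> slots induces
  an equivariant chain map of the join of \<open>N\<close> copies of \<open>Z\<^sub>p\<close> to itself that is null-homotopic on
  the augmented complex because of the cone with apex in a further slot, so its alternating trace
  is 0. As \<open>Z\<^sub>p\<close> acts freely on the nonempty simplices, the trace is also congruent modulo \<open>p\<close>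
  to the contribution 1 of the empty simplex.\<close>

section \<open>A Tucker lemma for cyclic groups\<close>

text \<open>A partial map encodes a simplex of the join of \<open>n\<close> copies of the discrete
  set Z_p, with at most one vertex in each copy (slot); \<open>Map.empty\<close> is the empty
  simplex of the augmented complex. Read as a colouring of slots, it is also a partial partition of
  \<open>{..<n}\<close> into \<open>p\<close> parts.\<close>

definition simplices :: "nat \<Rightarrow> nat \<Rightarrow> (nat \<rightharpoonup> nat) set" where
  "simplices n p = {X. dom X \<subseteq> {..<n} \<and> ran X \<subseteq> {..<p}}"

text \<open>The incidence sign of the vertex in slot \<open>i\<close>. Only slots below
  \<open>i\<close> count, so the sign is the same before and after slot \<open>i\<close> is
  filled.\<close>

definition sg :: "(nat \<rightharpoonup> nat) \<Rightarrow> nat \<Rightarrow> int" where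
  "sg X i = (-1) ^ card {j \<in> dom X. j < i}"

definition rot :: "nat \<Rightarrow> (nat \<rightharpoonup> nat) \<Rightarrow> (nat \<rightharpoonup> nat)" where
  "rot p X = map_option (\<lambda>a. Suc a mod p) \<circ> X"

lemma finite_simplices: "finite (simplices n p)"
proof -
  have "simplices n p \<subseteq> (\<Union>A\<in>Pow {..<n}. {X. dom X = A \<and> ran X \<subseteq> {..<p}})"
    by (auto simp: simplices_def)
  moreover have "finite (\<Union>A\<in>Pow {..<n}. {X. dom X = A \<and> ran X \<subseteq> {..<p}})"
    by (auto intro!: finite_set_of_finite_maps intro: finite_subset)
  ultimately show ?thesis by (rule finite_subset)
qed

lemma finite_dom_simplices: "X \<in> simplices n p \<Longrightarrow> finite (dom X)"
  by (auto simp: simplices_def intro: finite_subset)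

lemma simplices_del: "X \<in> simplices n p \<Longrightarrow> X(i := None) \<in> simplices n p"
  by (auto simp: simplices_def ran_def)

lemma simplices_upd: "X \<in> simplices n p \<Longrightarrow> i < n \<Longrightarrow> a < p \<Longrightarrow> X(i \<mapsto> a) \<in> simplices n p"
  by (auto simp: simplices_def ran_def)

lemma simplices_mono: "X \<in> simplices N p \<Longrightarrow> N \<le> n \<Longrightarrow> X \<in> simplices n p"
  by (auto simp: simplices_def)

lemma card_dom_del: "finite (dom X) \<Longrightarrow> i \<in> dom X \<Longrightarrow> card (dom (X(i := None))) = card (dom X) - 1"
  by simp

section \<open>Signs and the boundary operator\<close>

lemma sg_sq: "sg X i * sg X i = 1"
  by (simp add: sg_def flip: power_add mult_2)

lemma sg_del_self: "sg (X(i := None)) i = sg X i"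
proof -
  have "{j \<in> dom (X(i := None)). j < i} = {j \<in> dom X. j < i}" by auto
  thus ?thesis by (simp add: sg_def)
qed

lemma sg_upd:
  assumes "l \<notin> dom X"
  shows "sg (X(l \<mapsto> a)) i = (if l < i then - sg X i else sg X i)"
proof (cases "l < i")
  case True
  have "{j \<in> dom (X(l \<mapsto> a)). j < i} = insert l {j \<in> dom X. j < i}" using True by auto
  moreover have "finite {j \<in> dom X. j < i}" by simp
  ultimately show ?thesis using True assms by (simp add: sg_def)
next
  case False
  have "{j \<in> dom (X(l \<mapsto> a)). j < i} = {j \<in> dom X. j < i}" using False by auto
  thus ?thesis using False by (simp add: sg_def)
qed

lemma sg_del:
  assumes "l \<in> dom X"
  shows "sg (X(l := None)) i = (if l < i then - sg X i else sg X i)"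
proof -
  obtain a where a: "X l = Some a" using assms by auto
  have "X = (X(l := None))(l \<mapsto> a)" using a by auto
  hence "sg X i = (if l < i then - sg (X(l := None)) i else sg (X(l := None)) i)"
    using sg_upd[of l "X(l := None)" a i] by simp
  thus ?thesis by simp
qed

text \<open>Swapping the two indices shows that the sum equals its own negative.\<close>

lemma sum_antisym:
  fixes f :: "'a \<Rightarrow> 'a \<Rightarrow> int"
  assumes "finite A" and anti: "\<And>i j. i \<in> A \<Longrightarrow> j \<in> A \<Longrightarrow> i \<noteq> j \<Longrightarrow> f i j = - f j i"
  shows "(\<Sum>i\<in>A. \<Sum>j\<in>A - {i}. f i j) = 0"
proof -
  have "(\<Sum>i\<in>A. \<Sum>j\<in>A - {i}. f i j) = (\<Sum>(i,j)\<in>Sigma A (\<lambda>i. A - {i}). f i j)"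
    using assms by (subst sum.Sigma) auto
  also have "\<dots> = (\<Sum>(i,j)\<in>Sigma A (\<lambda>i. A - {i}). f j i)"
    by (rule sum.reindex_bij_witness[where i = prod.swap and j = prod.swap]) auto
  also have "\<dots> = (\<Sum>(i,j)\<in>Sigma A (\<lambda>i. A - {i}). - f i j)"
    by (rule sum.cong) (auto intro: anti)
  also have "\<dots> = - (\<Sum>(i,j)\<in>Sigma A (\<lambda>i. A - {i}). f i j)"
    by (simp add: case_prod_unfold sum_negf)
  also have "(\<Sum>(i,j)\<in>Sigma A (\<lambda>i. A - {i}). f i j) = (\<Sum>i\<in>A. \<Sum>j\<in>A - {i}. f i j)"
    using assms by (subst sum.Sigma) auto
  finally show ?thesis by simp
qed

text \<open>The square of the boundary is zero, evaluated against an arbitrary function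
  \<open>F\<close> of simplices. Two vertices can be deleted in either order, and the two orders
  carry opposite signs.\<close>

lemma boundary_boundary:
  assumes "finite (dom X)"
  shows "(\<Sum>i\<in>dom X. sg X i * (\<Sum>j\<in>dom (X(i := None)). sg (X(i := None)) j * F (X(i := None, j := None)))) = 0"
proof -
  have "(\<Sum>i\<in>dom X. sg X i * (\<Sum>j\<in>dom (X(i := None)). sg (X(i := None)) j * F (X(i := None, j := None))))
     = (\<Sum>i\<in>dom X. \<Sum>j\<in>dom X - {i}. sg X i * sg (X(i := None)) j * F (X(i := None, j := None)))"
    by (simp add: sum_distrib_left mult.assoc)
  also have "\<dots> = 0"
  proof (rule sum_antisym[OF assms])
    fix i j assume ij: "i \<in> dom X" "j \<in> dom X" "i \<noteq> j"
    have "X(i := None, j := None) = X(j := None, i := None)" using ij(3) by (rule fun_upd_twist)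
    moreover have "sg X i * sg (X(i := None)) j = - (sg X j * sg (X(j := None)) i)"
      using ij by (cases i j rule: linorder_cases) (simp_all add: sg_del)
    ultimately show "sg X i * sg (X(i := None)) j * F (X(i := None, j := None)) =
      - (sg X j * sg (X(j := None)) i * F (X(j := None, i := None)))" by simp
  qed
  finally show ?thesis .
qed

section \<open>The diagonal action of Z_p\<close>

lemma rot_simplices: "X \<in> simplices n p \<Longrightarrow> rot p X \<in> simplices n p"
  by (auto simp: simplices_def rot_def ran_def dom_def)

lemma dom_rot: "dom (rot p X) = dom X"
  by (auto simp: rot_def dom_def)

lemma rot_empty_iff: "rot p X = Map.empty \<longleftrightarrow> X = Map.empty"
  unfolding dom_eq_empty_conv[symmetric] dom_rot ..

lemma sg_rot: "sg (rot p X) i = sg X i"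
  by (simp add: sg_def dom_rot)

lemma rot_del: "rot p (X(i := None)) = (rot p X)(i := None)"
  by (auto simp: rot_def)

lemma Suc_mod_inj: "a < p \<Longrightarrow> b < p \<Longrightarrow> Suc a mod p = Suc b mod p \<longleftrightarrow> a = b"
  by (auto simp: mod_Suc split: if_splits)

lemma rot_inj: "X \<in> simplices n p \<Longrightarrow> Y \<in> simplices n p \<Longrightarrow> rot p X = rot p Y \<Longrightarrow> X = Y"
proof
  fix i assume a: "X \<in> simplices n p" "Y \<in> simplices n p" "rot p X = rot p Y"
  have "map_option (\<lambda>a. Suc a mod p) (X i) = map_option (\<lambda>a. Suc a mod p) (Y i)"
    using fun_cong[OF a(3), of i] by (simp add: rot_def)
  moreover have "x < p" if "X i = Some x" for x using a(1) that by (auto simp: simplices_def ran_def)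
  moreover have "y < p" if "Y i = Some y" for y using a(2) that by (auto simp: simplices_def ran_def)
  ultimately show "X i = Y i"
    by (cases "X i"; cases "Y i") (auto simp: Suc_mod_inj)
qed

lemma rot_bij: "bij_betw (rot p) (simplices n p) (simplices n p)"
proof -
  have "inj_on (rot p) (simplices n p)" by (auto intro: inj_onI rot_inj)
  moreover have "rot p ` simplices n p \<subseteq> simplices n p" using rot_simplices by auto
  ultimately show ?thesis
    using endo_inj_surj[OF finite_simplices] by (auto simp: bij_betw_def)
qed

section \<open>Equivariant labellings and the chain map they induce\<close>

text \<open>\<open>coef d X Y\<close> is the coefficient of the simplex \<open>Y\<close> in the image, under the chain map
  induced by the labelling, of the barycentric subdivision of the simplex \<open>X\<close> with \<open>d\<close> vertices:
  \<open>X\<close> is sent to the cone with apex its label over the image of its boundary.\<close>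

locale zp_labelling =
  fixes n N p :: nat and slot val :: "(nat \<rightharpoonup> nat) \<Rightarrow> nat"
  assumes p_ge: "p \<ge> 2"
    and slot_less: "X \<in> simplices n p \<Longrightarrow> X \<noteq> Map.empty \<Longrightarrow> slot X < N"
    and val_less: "X \<in> simplices n p \<Longrightarrow> X \<noteq> Map.empty \<Longrightarrow> val X < p"
    and slot_rot: "X \<in> simplices n p \<Longrightarrow> X \<noteq> Map.empty \<Longrightarrow> slot (rot p X) = slot X"
    and val_rot: "X \<in> simplices n p \<Longrightarrow> X \<noteq> Map.empty \<Longrightarrow> val (rot p X) = Suc (val X) mod p"
    and compat: "X \<in> simplices n p \<Longrightarrow> Y \<in> simplices n p \<Longrightarrow> X \<noteq> Map.empty \<Longrightarrow> X \<subseteq>\<^sub>m Y \<Longrightarrow>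
        slot X = slot Y \<Longrightarrow> val X = val Y"
begin

primrec coef :: "nat \<Rightarrow> (nat \<rightharpoonup> nat) \<Rightarrow> (nat \<rightharpoonup> nat) \<Rightarrow> int" where
  "coef 0 X Y = of_bool (Y = Map.empty)"
| "coef (Suc d) X Y = (if Y (slot X) = Some (val X)
     then sg Y (slot X) * (\<Sum>i\<in>dom X. sg X i * coef d (X(i := None)) (Y(slot X := None))) else 0)"

text \<open>Following the cone recursion, a vertex of a simplex in the image of \<open>X\<close> is
  either the apex, which is the label of \<open>X\<close>, or comes from the image of a face of
  \<open>X\<close>.\<close>

lemma coef_labels:
  "X \<in> simplices n p \<Longrightarrow> card (dom X) = d \<Longrightarrow> coef d X Y \<noteq> 0 \<Longrightarrow> Y l = Some b \<Longrightarrow>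
   \<exists>Z\<in>simplices n p. Z \<noteq> Map.empty \<and> Z \<subseteq>\<^sub>m X \<and> slot Z = l \<and> val Z = b"
proof (induction d arbitrary: X Y)
  case 0
  then show ?case by (auto split: if_splits)
next
  case (Suc d)
  have ne: "X \<noteq> Map.empty" using Suc.prems(2) by auto
  have Y: "Y (slot X) = Some (val X)" using Suc.prems(3) by (auto split: if_splits)
  show ?case
  proof (cases "l = slot X")
    case True
    then show ?thesis using Y Suc.prems ne by (intro bexI[of _ X]) auto
  next
    case False
    have "(\<Sum>i\<in>dom X. sg X i * coef d (X(i := None)) (Y(slot X := None))) \<noteq> 0"
      using Suc.prems(3) by (auto split: if_splits)
    then obtain i where i: "i \<in> dom X" "coef d (X(i := None)) (Y(slot X := None)) \<noteq> 0"
      by (metis (no_types, lifting) mult_zero_right sum.neutral)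
    have "card (dom (X(i := None))) = d"
      using Suc.prems(1,2) i(1) finite_dom_simplices by (subst card_dom_del) auto
    moreover have "(Y(slot X := None)) l = Some b" using False Suc.prems(4) by simp
    ultimately obtain Z where "Z \<in> simplices n p" "Z \<noteq> Map.empty" "Z \<subseteq>\<^sub>m X(i := None)" "slot Z = l" "val Z = b"
      using Suc.IH[OF simplices_del[OF Suc.prems(1)] _ i(2)] by blast
    moreover from this(3) have "Z \<subseteq>\<^sub>m X" by (rule map_le_trans) (rule upd_None_map_le)
    ultimately show ?thesis by blast
  qed
qed

text \<open>A nonzero coefficient would make the vertex of \<open>Y\<close> in slot
  \<open>slot X\<close> the label of a face of \<open>X\<close>; by \<open>compat\<close> that label
  has value \<open>val X\<close>. Hence a cone never puts two values into one slot.\<close>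

lemma coef_del_zero:
  assumes "X \<in> simplices n p" "card (dom X) = Suc d" "i \<in> dom X"
    "Y (slot X) = Some b" "b \<noteq> val X"
  shows "coef d (X(i := None)) Y = 0"
proof (rule ccontr)
  assume nz: "coef d (X(i := None)) Y \<noteq> 0"
  have "card (dom (X(i := None))) = d"
    using assms(1-3) finite_dom_simplices by (subst card_dom_del) auto
  from coef_labels[OF simplices_del[OF assms(1)] this nz assms(4)]
  obtain Z where Z: "Z \<in> simplices n p" "Z \<noteq> Map.empty" "Z \<subseteq>\<^sub>m X(i := None)" "slot Z = slot X" "val Z = b"
    by auto
  from Z(3) have "Z \<subseteq>\<^sub>m X" by (rule map_le_trans) (rule upd_None_map_le)
  from compat[OF Z(1) assms(1) Z(2) this Z(4)] Z(5) assms(5) show False by simp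
qed

text \<open>The left side is the coefficient of \<open>Y\<close> in the boundary of the image of
  \<open>X\<close>, collected over all ways to add a vertex to \<open>Y\<close>; the right side is
  its coefficient in the image of the boundary of \<open>X\<close>. The induction splits on what
  \<open>Y\<close> has in the slot of the apex.\<close>

lemma chain_map:
  assumes "X \<in> simplices n p" "card (dom X) = d"
  shows "(\<Sum>l\<in>{..<N} - dom Y. \<Sum>a<p. sg Y l * coef d X (Y(l \<mapsto> a)))
    = (\<Sum>i\<in>dom X. sg X i * coef (d - 1) (X(i := None)) Y)"
  using assms
proof (induction d arbitrary: X Y)
  \<comment> \<open>The empty simplex has no faces, so the truncated \<open>d - 1\<close> never
    enters; on the left, its image contains no nonempty simplex.\<close>
  case 0
  then have "dom X = {}" using finite_dom_simplices by auto
  moreover have "Y(l \<mapsto> a) \<noteq> Map.empty" for l a by (rule map_upd_nonempty)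
  ultimately show ?case by (simp del: fun_upd_apply)
next
  case (Suc d)
  define l0 a0 where "l0 = slot X" and "a0 = val X"
  have ne: "X \<noteq> Map.empty" using Suc.prems(2) by auto
  have l0: "l0 < N" and a0: "a0 < p"
    using slot_less val_less Suc.prems ne by (auto simp: l0_def a0_def)
  have fin: "finite (dom X)" using Suc.prems finite_dom_simplices by auto
  have cdel: "card (dom (X(i := None))) = d" if "i \<in> dom X" for i
    using Suc.prems(2) that fin by (subst card_dom_del) auto
  let ?B = "\<lambda>Y. \<Sum>i\<in>dom X. sg X i * coef d (X(i := None)) Y"
  have cSuc: "coef (Suc d) X Z = (if Z l0 = Some a0 then sg Z l0 * ?B (Z(l0 := None)) else 0)" for Z
    by (simp add: l0_def a0_def)
  have B0: "?B Z = 0" if "Z l0 = Some b" "b \<noteq> a0" for Z b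
    using coef_del_zero[OF Suc.prems] that by (intro sum.neutral) (auto simp: l0_def a0_def)
  consider "l0 \<notin> dom Y" | "Y l0 = Some a0" | b where "Y l0 = Some b" "b \<noteq> a0" by auto
  then show ?case
  proof cases
    \<comment> \<open>Every simplex in the image of \<open>X\<close> contains the apex, so adding
      the apex itself is the only way to obtain one from \<open>Y\<close>.\<close>
    case 1
    have "(\<Sum>l\<in>{..<N} - dom Y. \<Sum>a<p. sg Y l * coef (Suc d) X (Y(l \<mapsto> a)))
      = (\<Sum>l\<in>{..<N} - dom Y. if l = l0 then (\<Sum>a<p. if a = a0 then ?B Y else 0) else 0)"
    proof (rule sum.cong[OF refl])
      fix l assume "l \<in> {..<N} - dom Y"
      have e: "Y(l0 := None) = Y" using 1 by auto
      have "sg Y l0 * coef (Suc d) X (Y(l0 \<mapsto> a)) = (if a = a0 then ?B Y else 0)" for a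
        using 1 sg_sq[of Y l0] e
        by (simp del: coef.simps add: cSuc sg_upd flip: mult.assoc)
      moreover have "coef (Suc d) X (Y(l \<mapsto> a)) = 0" if "l \<noteq> l0" for a
        using that 1 by (simp del: coef.simps add: cSuc dom_def)
      ultimately show "(\<Sum>a<p. sg Y l * coef (Suc d) X (Y(l \<mapsto> a)))
         = (if l = l0 then (\<Sum>a<p. if a = a0 then ?B Y else 0) else 0)"
        by (simp del: coef.simps)
    qed
    also have "\<dots> = ?B Y" using 1 l0 a0 by simp
    finally show ?thesis unfolding diff_Suc_1 .
  next
    case 2
    let ?Y = "Y(l0 := None)"
    have dY: "{..<N} - dom ?Y = insert l0 ({..<N} - dom Y)" using 2 l0 by auto
    \<comment> \<open>The image of the boundary of \<open>X\<close> is a cycle, by the induction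
      hypothesis on the faces and \<open>boundary_boundary\<close>. This is the coefficient of
      \<open>?Y\<close>, that is \<open>Y\<close> without the apex, in its boundary.\<close>
    have "(\<Sum>l\<in>{..<N} - dom ?Y. \<Sum>a<p. sg ?Y l * ?B (?Y(l \<mapsto> a)))
      = (\<Sum>i\<in>dom X. sg X i * (\<Sum>l\<in>{..<N} - dom ?Y. \<Sum>a<p. sg ?Y l * coef d (X(i := None)) (?Y(l \<mapsto> a))))"
    proof -
      have "(\<Sum>l\<in>{..<N} - dom ?Y. \<Sum>a<p. sg ?Y l * ?B (?Y(l \<mapsto> a)))
        = (\<Sum>l\<in>{..<N} - dom ?Y. \<Sum>a<p. \<Sum>i\<in>dom X. sg X i * (sg ?Y l * coef d (X(i := None)) (?Y(l \<mapsto> a))))"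
        by (simp add: sum_distrib_left mult.left_commute)
      also have "\<dots> = (\<Sum>l\<in>{..<N} - dom ?Y. \<Sum>i\<in>dom X. \<Sum>a<p. sg X i * (sg ?Y l * coef d (X(i := None)) (?Y(l \<mapsto> a))))"
        by (intro sum.cong refl sum.swap)
      also have "\<dots> = (\<Sum>i\<in>dom X. \<Sum>l\<in>{..<N} - dom ?Y. \<Sum>a<p. sg X i * (sg ?Y l * coef d (X(i := None)) (?Y(l \<mapsto> a))))"
        by (rule sum.swap)
      finally show ?thesis by (simp only: sum_distrib_left)
    qed
    also have "\<dots> = (\<Sum>i\<in>dom X. sg X i * (\<Sum>j\<in>dom (X(i := None)). sg (X(i := None)) j * coef (d - 1) (X(i := None, j := None)) ?Y))"
      by (intro sum.cong refl arg_cong2[where f = "(*)"] Suc.IH simplices_del Suc.prems cdel)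
    also have "\<dots> = 0" by (rule boundary_boundary[OF fin])
    finally have zero: "(\<Sum>l\<in>{..<N} - dom ?Y. \<Sum>a<p. sg ?Y l * ?B (?Y(l \<mapsto> a))) = 0" .
    \<comment> \<open>The term for slot \<open>l0\<close> is isolated from the cycle relation; by
      \<open>B0\<close> only the value \<open>a0\<close> survives in it.\<close>
    have "(\<Sum>a<p. sg ?Y l0 * ?B (?Y(l0 \<mapsto> a))) = (\<Sum>a<p. if a = a0 then sg Y l0 * ?B Y else 0)"
    proof (intro sum.cong refl)
      fix a
      show "sg ?Y l0 * ?B (?Y(l0 \<mapsto> a)) = (if a = a0 then sg Y l0 * ?B Y else 0)"
      proof (cases "a = a0")
        case True
        have "Y(l0 \<mapsto> a0) = Y" using 2 by auto
        thus ?thesis using True by (simp add: sg_del_self)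
      next
        case False
        thus ?thesis using B0[of "?Y(l0 \<mapsto> a)" a] by simp
      qed
    qed
    hence "(\<Sum>a<p. sg ?Y l0 * ?B (?Y(l0 \<mapsto> a))) = sg Y l0 * ?B Y" using a0 by simp
    hence rest: "(\<Sum>l\<in>{..<N} - dom Y. \<Sum>a<p. sg ?Y l * ?B (?Y(l \<mapsto> a))) = - (sg Y l0 * ?B Y)"
      using zero 2 by (simp add: dY sum.insert domI del: dom_fun_upd)
    have "(\<Sum>l\<in>{..<N} - dom Y. \<Sum>a<p. sg Y l * coef (Suc d) X (Y(l \<mapsto> a)))
      = (\<Sum>l\<in>{..<N} - dom Y. \<Sum>a<p. - sg Y l0 * (sg ?Y l * ?B (?Y(l \<mapsto> a))))"
    proof (intro sum.cong refl)
      fix l a assume l: "l \<in> {..<N} - dom Y"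
      hence ll: "l \<noteq> l0" "l \<notin> dom Y" "l0 \<in> dom Y" using 2 by auto
      \<comment> \<open>Whichever of \<open>l\<close> and \<open>l0\<close> is smaller, exactly one
        of the two signs changes.\<close>
      have s: "sg Y l * sg (Y(l \<mapsto> a)) l0 = - sg Y l0 * sg ?Y l"
        using ll by (cases l l0 rule: linorder_cases) (simp_all add: sg_del sg_upd)
      have t: "(Y(l \<mapsto> a))(l0 := None) = ?Y(l \<mapsto> a)" using ll(1) by (rule fun_upd_twist)
      have "coef (Suc d) X (Y(l \<mapsto> a)) = sg (Y(l \<mapsto> a)) l0 * ?B (?Y(l \<mapsto> a))"
        unfolding cSuc t using 2 ll(1) by (intro if_P) simp
      thus "sg Y l * coef (Suc d) X (Y(l \<mapsto> a)) = - sg Y l0 * (sg ?Y l * ?B (?Y(l \<mapsto> a)))"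
        by (simp only: s flip: mult.assoc)
    qed
    also have "\<dots> = - sg Y l0 * - (sg Y l0 * ?B Y)"
      unfolding rest[symmetric] by (simp only: sum_distrib_left)
    also have "\<dots> = ?B Y" using sg_sq[of Y l0] by (simp flip: mult.assoc)
    finally show ?thesis unfolding diff_Suc_1 .
  next
    case 3
    have "coef (Suc d) X (Y(l \<mapsto> a)) = 0" if "l \<in> {..<N} - dom Y" for l a
      using that 3 by (auto simp del: coef.simps simp: cSuc)
    thus ?thesis using B0[of Y b] 3 by (simp del: coef.simps fun_upd_apply)
  qed
qed

section \<open>Equivariance of the chain map and its alternating trace\<close>

lemma coef_rot:
  "X \<in> simplices n p \<Longrightarrow> Y \<in> simplices M p \<Longrightarrow> card (dom X) = d \<Longrightarrow>
   coef d (rot p X) (rot p Y) = coef d X Y"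
proof (induction d arbitrary: X Y)
  case 0
  show ?case by (simp add: rot_empty_iff)
next
  case (Suc d)
  have ne: "X \<noteq> Map.empty" using Suc.prems(3) by auto
  have "(rot p Y (slot X) = Some (Suc (val X) mod p)) = (Y (slot X) = Some (val X))"
  proof -
    have "y < p" if "Y (slot X) = Some y" for y using that Suc.prems(2) by (auto simp: simplices_def ran_def)
    thus ?thesis using val_less[OF Suc.prems(1) ne] by (cases "Y (slot X)") (auto simp: rot_def Suc_mod_inj)
  qed
  moreover have "coef d ((rot p X)(i := None)) ((rot p Y)(l := None)) = coef d (X(i := None)) (Y(l := None))"
    if "i \<in> dom X" for i l
  proof -
    have "card (dom (X(i := None))) = d"
      using card_dom_del[OF finite_dom_simplices[OF Suc.prems(1)] that] Suc.prems(3) by simp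
    from Suc.IH[OF simplices_del[OF Suc.prems(1)] simplices_del[OF Suc.prems(2)] this]
    show ?thesis by (simp only: rot_del)
  qed
  ultimately show ?case
    using slot_rot[OF Suc.prems(1) ne] val_rot[OF Suc.prems(1) ne]
    by (simp add: sg_rot dom_rot)
qed

text \<open>The cone with apex in the additional slot \<open>N\<close> makes the restriction of the chain map to
  \<open>simplices N p\<close> null-homotopic on the augmented complex, so its alternating trace vanishes.\<close>

lemma trace_zero:
  assumes "N < n"
  shows "(\<Sum>X\<in>simplices N p. (-1) ^ card (dom X) * coef (card (dom X)) X X) = 0"
proof -
  \<comment> \<open>The chain homotopy: the image of the cone over \<open>X\<close> with apex of
    value 0 in slot \<open>N\<close>. The assumption \<open>N < n\<close> makes this cone a simplex
    of the source.\<close>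
  define H where "H X Y = coef (Suc (card (dom X))) (X(N \<mapsto> 0)) Y" for X Y
  let ?S = "simplices N p"
  \<comment> \<open>Diagonal part of the homotopy identity, from \<open>chain_map\<close> on the
    cone: its faces are \<open>X\<close> and the cones over the faces of \<open>X\<close>.\<close>
  have id: "(\<Sum>l\<in>{..<N} - dom X. \<Sum>a<p. sg X l * H X (X(l \<mapsto> a)))
     = (\<Sum>i\<in>dom X. sg X i * H (X(i := None)) X) + (-1) ^ card (dom X) * coef (card (dom X)) X X"
    if X: "X \<in> ?S" for X
  proof -
    let ?X = "X(N \<mapsto> 0)"
    have fin: "finite (dom X)" using X finite_dom_simplices by auto
    have N: "N \<notin> dom X" using X by (auto simp: simplices_def)
    have card: "card (dom ?X) = Suc (card (dom X))" using fin N by simp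
    have mem: "?X \<in> simplices n p"
      using simplices_upd[OF simplices_mono[OF X]] assms p_ge by simp
    have "(\<Sum>l\<in>{..<N} - dom X. \<Sum>a<p. sg X l * H X (X(l \<mapsto> a)))
      = (\<Sum>i\<in>insert N (dom X). sg ?X i * coef (card (dom X)) (?X(i := None)) X)"
      using chain_map[OF mem card, of X]
      by (simp only: H_def diff_Suc_1 dom_fun_upd option.distinct if_False)
    also have "\<dots> = sg ?X N * coef (card (dom X)) (?X(N := None)) X
        + (\<Sum>i\<in>dom X. sg ?X i * coef (card (dom X)) (?X(i := None)) X)"
      using fin N by (rule sum.insert)
    \<comment> \<open>The apex lies above every slot of \<open>X\<close>, and this produces the
      alternating sign of the trace.\<close>
    also have "sg ?X N = (-1) ^ card (dom X)"
    proof -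
      have "{j \<in> dom X. j < N} = dom X" using X by (auto simp: simplices_def)
      hence "sg X N = (-1) ^ card (dom X)" by (simp add: sg_def)
      thus ?thesis using sg_upd[OF N, of 0 N] by simp
    qed
    also have "?X(N := None) = X" using N by auto
    also have "(\<Sum>i\<in>dom X. sg ?X i * coef (card (dom X)) (?X(i := None)) X)
       = (\<Sum>i\<in>dom X. sg X i * H (X(i := None)) X)"
    proof (intro sum.cong refl)
      fix i assume i: "i \<in> dom X"
      have i': "i < N" "N \<noteq> i" using i X by (auto simp: simplices_def)
      have t: "?X(i := None) = (X(i := None))(N \<mapsto> 0)" using i'(2) by (rule fun_upd_twist)
      have c: "Suc (card (dom (X(i := None)))) = card (dom X)"
        unfolding dom_fun_upd if_P[OF refl] using fin i by (rule card_Suc_Diff1)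
      have s: "sg ?X i = sg X i" using sg_upd[OF N] i' by simp
      show "sg ?X i * coef (card (dom X)) (?X(i := None)) X = sg X i * H (X(i := None)) X"
        unfolding H_def c t s ..
    qed
    finally show ?thesis by (simp only: add.commute)
  qed
  have "(\<Sum>X\<in>?S. \<Sum>l\<in>{..<N} - dom X. \<Sum>a<p. sg X l * H X (X(l \<mapsto> a)))
    = (\<Sum>(X, l, a)\<in>Sigma ?S (\<lambda>X. ({..<N} - dom X) \<times> {..<p}). sg X l * H X (X(l \<mapsto> a)))"
    by (simp add: sum.cartesian_product finite_simplices sum.Sigma case_prod_unfold)
  \<comment> \<open>Both compositions of \<open>H\<close> with the boundary have the same trace:
    each is a sum over incident pairs of a simplex and one of its vertices. They therefore cancel in
    \<open>id\<close>.\<close>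
  also have "\<dots> = (\<Sum>(X, i)\<in>Sigma ?S dom. sg X i * H (X(i := None)) X)"
  proof (rule sum.reindex_bij_witness[where
      j = "\<lambda>(X, l, a). (X(l \<mapsto> a), l)" and i = "\<lambda>(X, l). (X(l := None), l, the (X l))"], goal_cases)
    case (1 z)
    then obtain X l a where "z = (X, l, a)" "l \<notin> dom X" by auto
    moreover from this have "(X(l \<mapsto> a))(l := None) = X" by auto
    ultimately show ?case by simp
  next
    case (2 z)
    then obtain X l a where z: "z = (X, l, a)" "X \<in> ?S" "l < N" "a < p" by auto
    then show ?case using simplices_upd[OF z(2-4)] by (simp del: fun_upd_apply)
  next
    case (3 z)
    then obtain X l a where z: "z = (X, l)" "X l = Some a" by auto
    then have "X(l \<mapsto> a) = X" by auto
    then show ?case using z by simp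
  next
    case (4 z)
    then obtain X l a where z: "z = (X, l)" "X \<in> ?S" "X l = Some a" by auto
    moreover have "l < N" "a < p" using z by (auto simp: simplices_def ran_def)
    ultimately show ?case using simplices_del[OF z(2), of l] by (simp del: fun_upd_apply)
  next
    case (5 z)
    then obtain X l a where "z = (X, l, a)" "l \<notin> dom X" by auto
    moreover from this have "(X(l \<mapsto> a))(l := None) = X" by auto
    ultimately show ?case by (simp add: sg_upd del: fun_upd_apply)
  qed
  also have "\<dots> = (\<Sum>X\<in>?S. \<Sum>i\<in>dom X. sg X i * H (X(i := None)) X)"
    using finite_simplices finite_dom_simplices by (subst sum.Sigma) auto
  finally show ?thesis using id by (simp add: sum.distrib)
qed

text \<open>Sorting the nonempty simplices by the value in their lowest occupied slot gives
  \<open>p\<close> classes, which rotation permutes cyclically. The summands are rotation invariant,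
  so all classes contribute equally.\<close>

lemma trace_mod:
  "int p dvd (\<Sum>X\<in>simplices N p - {Map.empty}. (-1) ^ card (dom X) * coef (card (dom X)) X X)"
  if "N \<le> n"
proof -
  define w where "w X = (-1) ^ card (dom X) * coef (card (dom X)) X X" for X
  define T where "T b = {X \<in> simplices N p. X \<noteq> Map.empty \<and> X (Min (dom X)) = Some b}" for b
  have wrot: "w (rot p X) = w X" if "X \<in> simplices N p" for X
    using coef_rot[OF simplices_mono[OF that \<open>N \<le> n\<close>] that refl] by (simp add: w_def dom_rot)
  have step: "sum w (T (Suc b)) = sum w (T b)" if b: "Suc b < p" for b
  proof -
    have "bij_betw (rot p) (T b) (T (Suc b))"
    proof (rule bij_betw_imageI)
      show "inj_on (rot p) (T b)" by (auto simp: T_def intro: inj_onI rot_inj)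
      show "rot p ` T b = T (Suc b)"
      proof (intro equalityI subsetI)
        fix Y assume "Y \<in> rot p ` T b"
        then obtain X where "X \<in> T b" "Y = rot p X" by blast
        thus "Y \<in> T (Suc b)" using b
          by (simp add: T_def rot_empty_iff dom_rot rot_simplices) (simp add: rot_def)
      next
        fix Y assume Y: "Y \<in> T (Suc b)"
        then obtain X where X: "X \<in> simplices N p" "Y = rot p X"
          using rot_bij[of p N] by (auto simp: T_def bij_betw_def)
        obtain a where a: "X (Min (dom X)) = Some a" "Suc a mod p = Suc b"
          using Y X(2) unfolding T_def mem_Collect_eq X(2) dom_rot by (auto simp: rot_def)
        have "a < p" using X(1) a(1) by (auto simp: simplices_def ran_def)
        hence "a = b" using a(2) b Suc_mod_inj[of a p b] by simp
        hence "X \<in> T b" using X Y a(1) by (simp add: T_def rot_empty_iff)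
        thus "Y \<in> rot p ` T b" using X(2) by blast
      qed
    qed
    from sum.reindex_bij_betw[OF this, of w]
    have "sum w (T (Suc b)) = (\<Sum>X\<in>T b. w (rot p X))" ..
    also have "\<dots> = sum w (T b)" by (intro sum.cong refl wrot) (simp add: T_def)
    finally show ?thesis .
  qed
  have T0: "sum w (T b) = sum w (T 0)" if "b < p" for b
    using that by (induction b) (simp_all add: step)
  have "simplices N p - {Map.empty} = (\<Union>b<p. T b)"
  proof (intro equalityI subsetI)
    fix X assume X: "X \<in> simplices N p - {Map.empty}"
    hence "Min (dom X) \<in> dom X" using finite_dom_simplices by (intro Min_in) auto
    thus "X \<in> (\<Union>b<p. T b)" using X by (auto simp: T_def simplices_def ran_def)
  qed (auto simp: T_def)
  moreover have "sum w (\<Union>b<p. T b) = (\<Sum>b<p. sum w (T b))"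
    by (rule sum.UNION_disjoint) (auto simp: T_def intro: finite_subset[OF _ finite_simplices])
  moreover have "\<dots> = (\<Sum>b<p. sum w (T 0))" by (intro sum.cong refl T0) simp
  ultimately have "sum w (simplices N p - {Map.empty}) = int p * sum w (T 0)" by simp
  thus ?thesis by (simp add: w_def)
qed

text \<open>A labelling is an equivariant simplicial map from the barycentric subdivision of the
  join of \<open>n\<close> copies of Z_p to the join of \<open>N\<close> copies, so this is a case
  of Dold's theorem.\<close>

theorem dimension_le: "n \<le> N"
proof (rule ccontr)
  assume "\<not> n \<le> N"
  hence N: "N < n" by simp
  define w where "w X = (-1) ^ card (dom X) * coef (card (dom X)) X X" for X
  have e: "Map.empty \<in> simplices N p" by (simp add: simplices_def)
  have "sum w (simplices N p) = 1 + sum w (simplices N p - {Map.empty})"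
    using sum.remove[OF finite_simplices e, of w] by (simp add: w_def)
  moreover have "sum w (simplices N p) = 0" using trace_zero[OF N] by (simp add: w_def)
  moreover have "int p dvd sum w (simplices N p - {Map.empty})"
    using trace_mod N by (simp add: w_def)
  moreover have "a = - 1" if "b = 1 + a" "b = 0" for a b :: int using that by simp
  ultimately have "int p dvd - 1" by fastforce
  thus False using p_ge by simp
qed

end

section \<open>Labelling by colours\<close>

definition part :: "(nat \<rightharpoonup> nat) \<Rightarrow> nat \<Rightarrow> nat set" where
  "part X i = {e. X e = Some i}"

definition shift :: "nat \<Rightarrow> nat set \<Rightarrow> nat set" where
  "shift p L = (\<lambda>j. Suc j mod p) ` L"

text \<open>For a nonempty proper subset \<open>L\<close> of a group of prime order \<open>p\<close>, the mean of the elements of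
  \<open>L\<close> is defined modulo \<open>p\<close> and commutes with translations.\<close>

definition mean :: "nat \<Rightarrow> nat set \<Rightarrow> nat" where
  "mean p L = ((SOME r. [card L * r = 1] (mod p)) * \<Sum>L) mod p"

lemma part_mono: "X \<subseteq>\<^sub>m Y \<Longrightarrow> part X i \<subseteq> part Y i"
  by (force simp: part_def map_le_def dom_def)

lemma part_subset: "X \<in> simplices n p \<Longrightarrow> part X i \<subseteq> {..<n}"
  by (auto simp: part_def simplices_def)

lemma finite_part: "X \<in> simplices n p \<Longrightarrow> finite (part X i)"
  by (rule finite_subset[OF part_subset]) auto

lemma part_rot: "X \<in> simplices n p \<Longrightarrow> i < p \<Longrightarrow> part (rot p X) (Suc i mod p) = part X i"
proof -
  assume X: "X \<in> simplices n p" and i: "i < p"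
  have "a < p" if "X e = Some a" for e a using X that by (auto simp: simplices_def ran_def)
  thus ?thesis using i by (auto simp: part_def rot_def Suc_mod_inj)
qed

lemma inj_on_Suc_mod: "L \<subseteq> {..<p} \<Longrightarrow> inj_on (\<lambda>j. Suc j mod p) L"
  by (rule inj_onI) (auto simp: Suc_mod_inj subset_eq)

lemma card_shift: "L \<subseteq> {..<p} \<Longrightarrow> card (shift p L) = card L"
  unfolding shift_def by (rule card_image[OF inj_on_Suc_mod])

lemma shift_subset: "p > 0 \<Longrightarrow> shift p L \<subseteq> {..<p}"
  by (auto simp: shift_def)

lemma shift_empty_iff: "shift p L = {} \<longleftrightarrow> L = {}"
  by (simp add: shift_def)

lemma shift_full_iff:
  assumes "L \<subseteq> {..<p}" "p > 0"
  shows "shift p L = {..<p} \<longleftrightarrow> L = {..<p}"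
proof
  assume "shift p L = {..<p}"
  hence "card L = card {..<p}" using card_shift[OF assms(1)] by simp
  thus "L = {..<p}" using assms(1) by (intro card_subset_eq) auto
next
  assume L: "L = {..<p}"
  show "shift p L = {..<p}"
    using shift_subset[OF assms(2), of L] card_shift[OF assms(1)] L by (intro card_subset_eq) auto
qed

text \<open>Reduces the equivariance of \<open>big\<close> and \<open>starts\<close> to a check at
  one index; the shift is onto \<open>{..<p}\<close>, so every index is reached.\<close>

lemma Collect_shift:
  assumes "p > 0" and PQ: "\<And>i. i < p \<Longrightarrow> Q (Suc i mod p) \<longleftrightarrow> P i"
  shows "{i. i < p \<and> Q i} = shift p {i. i < p \<and> P i}"
proof (intro equalityI subsetI)
  fix j assume j: "j \<in> {i. i < p \<and> Q i}"
  have "shift p {..<p} = {..<p}" using shift_full_iff[of "{..<p}" p] assms(1) by simp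
  hence "j \<in> shift p {..<p}" using j by simp
  then obtain i where i: "i < p" "j = Suc i mod p" by (auto simp: shift_def)
  thus "j \<in> shift p {i. i < p \<and> P i}" using j PQ[OF i(1)] by (auto simp: shift_def)
next
  fix j assume "j \<in> shift p {i. i < p \<and> P i}"
  then obtain i where "i < p" "P i" "j = Suc i mod p" by (auto simp: shift_def)
  thus "j \<in> {i. i < p \<and> Q i}" using PQ[of i] assms(1) by simp
qed

lemma mean_less: "p > 0 \<Longrightarrow> mean p L < p"
  by (simp add: mean_def)

text \<open>Translation by 1 adds \<open>card L\<close> to the sum modulo \<open>p\<close>, and the
  inverse \<open>r\<close> of \<open>card L\<close> turns this into 1. The inverse exists because
  \<open>0 < card L < p\<close> and \<open>p\<close> is prime.\<close>

lemma mean_shift: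
  assumes "prime p" "L \<subseteq> {..<p}" "L \<noteq> {}" "L \<noteq> {..<p}"
  shows "mean p (shift p L) = Suc (mean p L) mod p"
proof -
  define r where "r = (SOME r. [card L * r = 1] (mod p))"
  have fin: "finite L" using assms(2) finite_subset by blast
  have "card L < card {..<p}" using assms by (intro psubset_card_mono) auto
  moreover have "0 < card L" using fin assms(3) by (simp add: card_gt_0_iff)
  ultimately have "\<not> p dvd card L" using nat_dvd_not_less by simp
  hence "coprime (card L) p" using assms(1) by (metis coprime_commute prime_imp_coprime)
  hence "\<exists>r. [card L * r = 1] (mod p)" using cong_solve_coprime_nat by fastforce
  hence r: "[card L * r = 1] (mod p)" unfolding r_def by (rule someI_ex)
  have "\<Sum>(shift p L) = (\<Sum>j\<in>L. Suc j mod p)"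
    unfolding shift_def using sum.reindex[OF inj_on_Suc_mod[OF assms(2)], of "\<lambda>x. x"] by simp
  also have "[\<dots> = (\<Sum>j\<in>L. Suc j)] (mod p)" by (intro cong_sum) (simp add: cong_def)
  also have "(\<Sum>j\<in>L. Suc j) = \<Sum>L + card L" by (simp add: sum_Suc)
  finally have "[r * \<Sum>(shift p L) = r * (\<Sum>L + card L)] (mod p)" by (rule cong_scalar_left)
  also have "r * (\<Sum>L + card L) = r * \<Sum>L + card L * r" by (simp add: algebra_simps)
  also have "[\<dots> = r * \<Sum>L + 1] (mod p)" by (intro cong_add r) simp
  finally have "(r * \<Sum>(shift p L)) mod p = Suc (r * \<Sum>L) mod p" by (simp add: cong_def)
  thus ?thesis unfolding mean_def card_shift[OF assms(2)] r_def[symmetric] by (simp add: mod_Suc_eq)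
qed

section \<open>The labelling defined by a proper colouring\<close>

locale kneser_colouring =
  fixes n k p c :: nat and f :: "nat set list \<Rightarrow> nat"
  assumes prime: "prime p" and k_pos: "k > 0"
    and proper: "proper_coloring (KN_vertices n k (p - 1)) (KN_adj (p - 1)) c f"
begin

definition big :: "(nat \<rightharpoonup> nat) \<Rightarrow> nat set" where
  "big X = {i. i < p \<and> k \<le> card (part X i)}"

text \<open>\<open>Suc\<close> moves the ground set \<open>{..<n}\<close> of the simplices to the
  ground set \<open>{1..n}\<close> of the graph. A vertex starting at \<open>j\<close> avoids
  exactly the part cyclically before \<open>j\<close>.\<close>

definition starts :: "(nat \<rightharpoonup> nat) \<Rightarrow> nat \<Rightarrow> nat set" where
  "starts X h = {j. j < p \<and> (\<exists>As\<in>KN_vertices n k (p - 1). f As = h \<and>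
     (\<forall>i<p - 1. As ! i \<subseteq> Suc ` part X ((j + i) mod p)))}"

definition hue :: "(nat \<rightharpoonup> nat) \<Rightarrow> nat" where
  "hue X = (LEAST h. starts X h \<noteq> {})"

text \<open>Consecutive blocks of slots: \<open>p * (k - 1)\<close> for small parts,
  \<open>p - 1\<close> for proper sets of large parts, and \<open>p - 1\<close> for each colour.
  Subtracting 1 lets each block start at size one.\<close>

definition label_slot :: "(nat \<rightharpoonup> nat) \<Rightarrow> nat" where
  "label_slot X = (if big X = {} then card (dom X) - 1
     else if big X \<noteq> {..<p} then p * (k - 1) + (card (big X) - 1)
     else p * (k - 1) + (p - 1) + ((p - 1) * hue X + (card (starts X (hue X)) - 1)))"

definition label_val :: "(nat \<rightharpoonup> nat) \<Rightarrow> nat" where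
  "label_val X = (if big X = {} then the (X (Min (dom X)))
     else if big X \<noteq> {..<p} then mean p (big X) else mean p (starts X (hue X)))"

lemma p_ge2: "p \<ge> 2"
  using prime by (rule prime_ge_2_nat)

lemma p_pos: "p > 0"
  using p_ge2 by simp

lemma big_subset: "big X \<subseteq> {..<p}"
  by (auto simp: big_def)

lemma starts_subset: "starts X h \<subseteq> {..<p}"
  by (auto simp: starts_def)

lemma big_mono:
  assumes "Y \<in> simplices n p" "X \<subseteq>\<^sub>m Y"
  shows "big X \<subseteq> big Y"
proof
  fix i assume "i \<in> big X"
  moreover have "card (part X i) \<le> card (part Y i)"
    using assms by (intro card_mono finite_part part_mono)
  ultimately show "i \<in> big Y" by (simp add: big_def)
qed

lemma starts_mono:
  assumes "X \<subseteq>\<^sub>m Y"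
  shows "starts X h \<subseteq> starts Y h"
proof
  fix j assume "j \<in> starts X h"
  then obtain As where As: "As \<in> KN_vertices n k (p - 1)" "f As = h" "j < p"
      "\<And>i. i < p - 1 \<Longrightarrow> As ! i \<subseteq> Suc ` part X ((j + i) mod p)"
    by (auto simp: starts_def)
  have "As ! i \<subseteq> Suc ` part Y ((j + i) mod p)" if "i < p - 1" for i
    using As(4)[OF that] image_mono[OF part_mono[OF assms]] by (rule subset_trans)
  thus "j \<in> starts Y h" using As(1-3) unfolding starts_def by blast
qed

lemma big_rot: "X \<in> simplices n p \<Longrightarrow> big (rot p X) = shift p (big X)"
  unfolding big_def by (rule Collect_shift[OF p_pos]) (simp add: part_rot)

lemma starts_rot: "X \<in> simplices n p \<Longrightarrow> starts (rot p X) h = shift p (starts X h)"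
  unfolding starts_def
proof (rule Collect_shift[OF p_pos])
  fix j assume X: "X \<in> simplices n p" and "j < p"
  have "part (rot p X) ((Suc j mod p + i) mod p) = part X ((j + i) mod p)" for i
  proof -
    have "(Suc j mod p + i) mod p = Suc ((j + i) mod p) mod p" by (simp add: mod_simps)
    thus ?thesis using part_rot[OF X, of "(j + i) mod p"] p_pos by simp
  qed
  thus "(\<exists>As\<in>KN_vertices n k (p - 1). f As = h \<and>
       (\<forall>i<p - 1. As ! i \<subseteq> Suc ` part (rot p X) ((Suc j mod p + i) mod p))) \<longleftrightarrow>
     (\<exists>As\<in>KN_vertices n k (p - 1). f As = h \<and> (\<forall>i<p - 1. As ! i \<subseteq> Suc ` part X ((j + i) mod p)))"
    by simp
qed

lemma hue_rot: "X \<in> simplices n p \<Longrightarrow> hue (rot p X) = hue X"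
  by (simp add: hue_def starts_rot shift_empty_iff)

text \<open>Otherwise vertices of colour \<open>h\<close> start at both 0 and 1. The
  \<open>l\<close>-th set of the first lies in part \<open>l\<close> and the \<open>r\<close>-th set
  of the second in part \<open>r + 1\<close>, with no wrap-around as \<open>r + 1 < p\<close>. For
  \<open>l \<le> r\<close> these parts differ, so the vertices are adjacent.\<close>

lemma starts_not_full: "starts X h \<noteq> {..<p}"
proof
  assume full: "starts X h = {..<p}"
  have "0 \<in> starts X h" unfolding full using p_ge2 by simp
  then obtain As where A: "As \<in> KN_vertices n k (p - 1)" "f As = h"
      "\<And>i. i < p - 1 \<Longrightarrow> As ! i \<subseteq> Suc ` part X ((0 + i) mod p)"
    unfolding starts_def by blast
  have "1 \<in> starts X h" unfolding full using p_ge2 by simp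
  then obtain Bs where B: "Bs \<in> KN_vertices n k (p - 1)" "f Bs = h"
      "\<And>i. i < p - 1 \<Longrightarrow> Bs ! i \<subseteq> Suc ` part X ((1 + i) mod p)"
    unfolding starts_def by blast
  have disj: "As ! l \<inter> Bs ! r = {}" if "l \<le> r" "r < p - 1" for l r
  proof -
    have "As ! l \<subseteq> Suc ` part X l" "Bs ! r \<subseteq> Suc ` part X (Suc r)"
      using A(3)[of l, simplified] B(3)[of r, simplified] that by simp_all
    moreover have "part X l \<inter> part X (Suc r) = {}" using that by (auto simp: part_def)
    ultimately show ?thesis by auto
  qed
  have "KN_cond (p - 1) As Bs"
    unfolding KN_cond_def
  proof (intro allI impI equals0I)
    fix i x assume "x \<in> (\<Union>l\<in>{0..i}. As ! l) \<inter> (\<Union>l\<in>{i..<p - 1}. Bs ! l)"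
    then obtain l r where "l \<le> i" "x \<in> As ! l" "i \<le> r" "r < p - 1" "x \<in> Bs ! r" by auto
    thus False using disj[of l r] by (meson disjoint_iff le_trans)
  qed
  hence "f As \<noteq> f Bs" using proper A(1) B(1) unfolding proper_coloring_def KN_adj_def by blast
  thus False using A(2) B(2) by simp
qed

text \<open>Choosing \<open>k\<close> elements in each of the parts 0 to \<open>p - 2\<close> gives
  a vertex starting at 0; its colour bounds the least one from above.\<close>

lemma hue_props:
  assumes X: "X \<in> simplices n p" and full: "big X = {..<p}"
  shows "hue X < c" "starts X (hue X) \<noteq> {}"
proof -
  have "\<exists>S. S \<subseteq> part X i \<and> card S = k" if "i < p" for i
    using full that obtain_subset_with_card_n[of k "part X i"] by (auto simp: big_def)
  then obtain S where S: "\<And>i. i < p \<Longrightarrow> S i \<subseteq> part X i" "\<And>i. i < p \<Longrightarrow> card (S i) = k" by metis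
  have S1: "S i \<subseteq> part X i" if "i < p - 1" for i using S(1)[of i] that by simp
  define As where "As = map (\<lambda>i. Suc ` S i) [0..<p - 1]"
  have nth: "As ! i = Suc ` S i" if "i < p - 1" for i using that by (simp add: As_def)
  have "As \<in> KN_vertices n k (p - 1)"
    unfolding KN_vertices_def
  proof (intro CollectI conjI allI impI)
    show "length As = p - 1" by (simp add: As_def)
  next
    fix i assume i: "i < p - 1"
    have "S i \<subseteq> {..<n}" using S1[OF i] part_subset[OF X, of i] by (rule subset_trans)
    thus "As ! i \<subseteq> {1..n}" using nth[OF i] by auto
    show "card (As ! i) = k" using nth[OF i] S(2)[of i] i by (simp add: card_image)
  next
    fix i j assume ij: "i < p - 1" "j < p - 1" "i \<noteq> j"
    have "part X i \<inter> part X j = {}" using ij by (auto simp: part_def)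
    thus "As ! i \<inter> As ! j = {}"
      unfolding nth[OF ij(1)] nth[OF ij(2)] using S1[OF ij(1)] S1[OF ij(2)] by blast
  qed
  moreover from this have "f As < c" using proper by (simp add: proper_coloring_def)
  moreover have "As ! i \<subseteq> Suc ` part X ((0 + i) mod p)" if "i < p - 1" for i
    using image_mono[OF S1[OF that]] that unfolding nth[OF that] by simp
  ultimately have ne: "starts X (f As) \<noteq> {}" and less: "f As < c"
    using p_pos unfolding starts_def by blast+
  show "starts X (hue X) \<noteq> {}" unfolding hue_def using ne by (rule LeastI)
  have "hue X \<le> f As" unfolding hue_def using ne by (rule Least_le)
  thus "hue X < c" using less by simp
qed

lemma card_dom_le:
  assumes X: "X \<in> simplices n p" and small: "big X = {}"
  shows "card (dom X) \<le> p * (k - 1)"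
proof -
  have "dom X \<subseteq> (\<Union>i<p. part X i)" using X by (force simp: simplices_def part_def ran_def)
  hence "card (dom X) \<le> card (\<Union>i<p. part X i)" using finite_part[OF X] by (intro card_mono) auto
  also have "\<dots> \<le> (\<Sum>i<p. card (part X i))" by (rule card_UN_le) simp
  also have "\<dots> \<le> (\<Sum>i<p. k - 1)"
  proof (rule sum_mono)
    fix i assume "i \<in> {..<p}"
    hence "\<not> k \<le> card (part X i)" using small by (auto simp: big_def)
    thus "card (part X i) \<le> k - 1" by simp
  qed
  finally show ?thesis by simp
qed

lemma card_proper:
  assumes "L \<subseteq> {..<p}" "L \<noteq> {}" "L \<noteq> {..<p}"
  shows "0 < card L" "card L - 1 < p - 1"
proof -
  show "0 < card L" using assms by (metis card_gt_0_iff finite_lessThan finite_subset)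
  have "card L < card {..<p}" using assms by (intro psubset_card_mono) auto
  thus "card L - 1 < p - 1" using \<open>0 < card L\<close> by simp
qed

lemma starts_hue_proper:
  assumes "X \<in> simplices n p" "big X = {..<p}"
  shows "0 < card (starts X (hue X))" "card (starts X (hue X)) - 1 < p - 1"
  using card_proper[OF starts_subset hue_props(2)[OF assms] starts_not_full] by auto

lemma card_dom_pos: "X \<in> simplices n p \<Longrightarrow> X \<noteq> Map.empty \<Longrightarrow> 0 < card (dom X)"
  using finite_dom_simplices by (auto simp: card_gt_0_iff)

section \<open>Verification of the labelling axioms\<close>

lemma label_slot_small:
  assumes "X \<in> simplices n p" "X \<noteq> Map.empty" "big X = {}"
  shows "label_slot X < p * (k - 1)"
  using card_dom_le[OF assms(1,3)] card_dom_pos[OF assms(1,2)] assms(3) by (simp add: label_slot_def)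

lemma label_slot_middle:
  assumes "big X \<noteq> {}" "big X \<noteq> {..<p}"
  shows "label_slot X < p * (k - 1) + (p - 1)"
  using card_proper[OF big_subset assms] assms by (simp add: label_slot_def)

lemma label_slot_less:
  assumes X: "X \<in> simplices n p" "X \<noteq> Map.empty"
  shows "label_slot X < p * (k - 1) + (p - 1) + (p - 1) * c"
proof -
  consider "big X = {}" | "big X \<noteq> {}" "big X \<noteq> {..<p}" | "big X = {..<p}" by blast
  thus ?thesis
  proof cases
    case 1
    thus ?thesis using label_slot_small[OF X] by simp
  next
    case 2
    thus ?thesis using label_slot_middle by (simp add: trans_less_add1)
  next
    case 3
    have ne: "big X \<noteq> {}" using 3 p_pos by (auto simp: lessThan_empty_iff)
    have "(p - 1) * hue X + (card (starts X (hue X)) - 1) < (p - 1) * Suc (hue X)"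
      using starts_hue_proper[OF X(1) 3] by simp
    also have "\<dots> \<le> (p - 1) * c" using hue_props(1)[OF X(1) 3] by (intro mult_le_mono2) simp
    finally have "(p - 1) * hue X + (card (starts X (hue X)) - 1) < (p - 1) * c" .
    moreover have "label_slot X = p * (k - 1) + (p - 1) + ((p - 1) * hue X + (card (starts X (hue X)) - 1))"
      using 3 ne by (simp add: label_slot_def)
    ultimately show ?thesis by (simp only: add_strict_left_mono)
  qed
qed

lemma label_val_less:
  assumes X: "X \<in> simplices n p" "X \<noteq> Map.empty"
  shows "label_val X < p"
proof -
  have "Min (dom X) \<in> dom X" using X finite_dom_simplices by (intro Min_in) auto
  hence "the (X (Min (dom X))) < p" using X by (auto simp: simplices_def ran_def)
  thus ?thesis by (simp add: label_val_def mean_less p_pos)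
qed

lemma label_slot_rot:
  assumes "X \<in> simplices n p"
  shows "label_slot (rot p X) = label_slot X"
  using assms by (simp add: label_slot_def big_rot starts_rot hue_rot dom_rot shift_empty_iff
    shift_full_iff card_shift big_subset starts_subset p_pos)

lemma label_val_rot:
  assumes X: "X \<in> simplices n p" "X \<noteq> Map.empty"
  shows "label_val (rot p X) = Suc (label_val X) mod p"
proof -
  consider "big X = {}" | "big X \<noteq> {}" "big X \<noteq> {..<p}" | "big X = {..<p}" by blast
  thus ?thesis
  proof cases
    case 1
    \<comment> \<open>Rotation keeps the domain, so the same least element is read off and its value
      moves by one.\<close>
    have "Min (dom X) \<in> dom X" using X finite_dom_simplices by (intro Min_in) auto
    then obtain a where "X (Min (dom X)) = Some a" by blast
    moreover have "big (rot p X) = {}" using 1 X(1) by (simp add: big_rot shift_empty_iff)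
    ultimately show ?thesis using 1 by (simp add: label_val_def dom_rot) (simp add: rot_def)
  next
    case 2
    thus ?thesis using X(1) mean_shift[OF prime big_subset 2]
      by (simp add: label_val_def big_rot shift_empty_iff shift_full_iff big_subset p_pos)
  next
    case 3
    have ne: "big X \<noteq> {}" using 3 p_pos by (auto simp: lessThan_empty_iff)
    have "shift p (big X) = {..<p}" using shift_full_iff[OF big_subset p_pos] 3 by (rule iffD2)
    thus ?thesis using 3 ne X(1)
        mean_shift[OF prime starts_subset hue_props(2)[OF X(1) 3] starts_not_full]
      by (simp add: label_val_def big_rot starts_rot hue_rot)
  qed
qed

text \<open>Equal slots place \<open>X\<close> and \<open>Y\<close> in the same block with equal
  sizes. The set behind the label grows with the simplex, so equal size forces equal sets and hence
  equal values.\<close>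

lemma label_compat:
  assumes X: "X \<in> simplices n p" and Y: "Y \<in> simplices n p" and ne: "X \<noteq> Map.empty"
    and le: "X \<subseteq>\<^sub>m Y" and eq: "label_slot X = label_slot Y"
  shows "label_val X = label_val Y"
proof -
  have bm: "big X \<subseteq> big Y" using big_mono[OF Y le] .
  have finY: "finite (big Y)" by (rule finite_subset[OF big_subset finite_lessThan])
  consider "big X = {}" | "big X \<noteq> {}" "big X \<noteq> {..<p}" | "big X = {..<p}" by blast
  thus ?thesis
  proof cases
    case 1
    have bY: "big Y = {}"
    proof (rule ccontr)
      assume "big Y \<noteq> {}"
      hence "p * (k - 1) \<le> label_slot Y" by (simp add: label_slot_def)
      thus False using label_slot_small[OF X ne 1] eq by linarith
    qed
    have neY: "Y \<noteq> Map.empty" using map_le_implies_dom_le[OF le] ne by auto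
    have "card (dom X) - 1 = card (dom Y) - 1" using eq by (simp only: label_slot_def 1 bY refl if_True)
    hence "card (dom X) = card (dom Y)" using card_dom_pos[OF X ne] card_dom_pos[OF Y neY] by linarith
    with finite_dom_simplices[OF Y] map_le_implies_dom_le[OF le] have "dom X = dom Y"
      by (rule card_subset_eq)
    hence "Y \<subseteq>\<^sub>m X" using le by (simp add: map_le_def)
    with le have "X = Y" by (rule map_le_antisym)
    thus ?thesis by simp
  next
    case 2
    have bY: "big Y \<noteq> {}" using 2 bm by auto
    have bY': "big Y \<noteq> {..<p}"
    proof
      assume "big Y = {..<p}"
      hence "p * (k - 1) + (p - 1) \<le> label_slot Y" using bY by (simp add: label_slot_def)
      thus False using label_slot_middle[OF 2] eq by linarith
    qed
    have "p * (k - 1) + (card (big X) - 1) = p * (k - 1) + (card (big Y) - 1)"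
      using eq 2 bY bY' by (simp only: label_slot_def if_False if_True not_False_eq_True)
    hence "card (big X) = card (big Y)"
      using card_proper(1)[OF big_subset 2] card_proper(1)[OF big_subset bY bY'] by linarith
    with finY bm have "big X = big Y" by (rule card_subset_eq)
    thus ?thesis using 2 by (simp add: label_val_def)
  next
    case 3
    have bY: "big Y = {..<p}" using bm big_subset[of Y] unfolding 3 by (intro subset_antisym)
    have ne: "{..<p} \<noteq> {}" using p_pos by (auto simp: lessThan_empty_iff)
    let ?u = "card (starts X (hue X)) - 1" and ?v = "card (starts Y (hue Y)) - 1"
    have u: "?u < p - 1" and v: "?v < p - 1"
      using starts_hue_proper(2)[OF X 3] starts_hue_proper(2)[OF Y bY] .
    have e: "(p - 1) * hue X + ?u = (p - 1) * hue Y + ?v"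
      using eq 3 bY ne by (simp add: label_slot_def)
    \<comment> \<open>The size term is below \<open>p - 1\<close>, so division by
      \<open>p - 1\<close> recovers the colour.\<close>
    have h: "hue X = hue Y"
      using arg_cong[OF e, of "\<lambda>t. t div (p - 1)"] u v by simp
    hence "card (starts X (hue X)) = card (starts Y (hue X))"
      using e starts_hue_proper(1)[OF X 3] starts_hue_proper(1)[OF Y bY] by simp
    hence "starts X (hue X) = starts Y (hue X)"
      by (rule card_subset_eq[OF finite_subset[OF starts_subset finite_lessThan] starts_mono[OF le]])
    thus ?thesis using 3 bY ne h by (simp add: label_val_def)
  qed
qed

lemma colours_bound: "n \<le> p * (k - 1) + (p - 1) + (p - 1) * c"
proof -
  interpret zp_labelling n "p * (k - 1) + (p - 1) + (p - 1) * c" p label_slot label_val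
    by (rule zp_labelling.intro;
        (rule p_ge2 label_slot_less label_val_less label_slot_rot label_val_rot label_compat; assumption))
  show ?thesis by (rule dimension_le)
qed

end

section \<open>Passing to the chromatic number\<close>

lemma finite_KN_vertices: "finite (KN_vertices n k m)"
proof (rule finite_subset)
  show "KN_vertices n k m \<subseteq> {xs. set xs \<subseteq> Pow {1..n} \<and> length xs = m}"
  proof (intro subsetI CollectI conjI)
    fix As A assume As: "As \<in> KN_vertices n k m" and "A \<in> set As"
    then obtain i where "i < length As" "A = As ! i" by (auto simp: in_set_conv_nth)
    with As show "A \<in> Pow {1..n}" by (simp add: KN_vertices_def)
  qed (simp add: KN_vertices_def)
  show "finite {xs. set xs \<subseteq> Pow {1..n} \<and> length xs = m}"
    by (rule finite_lists_length_eq) simp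
qed

text \<open>Loops would rule out every proper colouring and leave \<open>LEAST\<close> unspecified.
  The nonempty first set violates the condition at index 0.\<close>

lemma KN_adj_irrefl:
  assumes "As \<in> KN_vertices n k m" "m > 0" "k > 0"
  shows "\<not> KN_adj m As As"
proof -
  have "card (As ! 0) = k" using assms by (auto simp: KN_vertices_def)
  hence "As ! 0 \<noteq> {}" using assms(3) by auto
  then obtain x where "x \<in> As ! 0" by blast
  hence "x \<in> (\<Union>l\<in>{0..0}. As ! l) \<inter> (\<Union>l\<in>{0..<m}. As ! l)" using assms(2) by auto
  hence "\<not> KN_cond m As As" using assms(2) unfolding KN_cond_def by blast
  thus ?thesis by (simp add: KN_adj_def)
qed

text \<open>An injective colouring is proper on a finite loopless graph, so the least number of
  colours is attained.\<close>

lemma chromatic_number_colouring: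
  assumes "finite V" "\<And>v. v \<in> V \<Longrightarrow> \<not> E v v"
  shows "\<exists>f. proper_coloring V E (chromatic_number V E) f"
proof -
  obtain g where g: "bij_betw g V {0..<card V}" using ex_bij_betw_finite_nat[OF assms(1)] by blast
  have "proper_coloring V E (card V) g"
    using g assms(2) by (auto simp: proper_coloring_def bij_betw_def inj_on_def)
  hence "\<exists>c f. proper_coloring V E c f" by blast
  thus ?thesis unfolding chromatic_number_def by (rule LeastI_ex)
qed

theorem theorem4p2:
  fixes n k m p :: nat
  assumes "n \<ge> 2" "k \<ge> 2" "m \<ge> 2"
    and "n \<ge> (m + 1) * k"
    and "p = m + 1" and "prime p"
  shows "real (chromatic_number (KN_vertices n k m) (KN_adj m))
           \<ge> (real n / real p - real k) / (real p * (real p - 1))"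
proof -
  define c where "c = chromatic_number (KN_vertices n k m) (KN_adj m)"
  have "\<not> KN_adj m As As" if "As \<in> KN_vertices n k m" for As
    using KN_adj_irrefl[OF that] assms(2,3) by simp
  from chromatic_number_colouring[where E = "KN_adj m", OF finite_KN_vertices this]
  obtain f where "proper_coloring (KN_vertices n k m) (KN_adj m) c f"
    unfolding c_def by blast
  then interpret kneser_colouring n k p c f
    using assms by unfold_locales auto
  \<comment> \<open>The constant term in \<open>colours_bound\<close> is \<open>p * k - 1\<close>;
    the saved 1 is dropped.\<close>
  have "n \<le> p * k + (p - 1) * c"
    using colours_bound k_pos by (cases k) simp_all
  hence "real n \<le> real (p * k + (p - 1) * c)" by (rule of_nat_mono)
  hence "real n \<le> real p * real k + (real p - 1) * real c" using p_ge2 by (simp add: of_nat_diff)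
  moreover have "(real n / real p - real k) * real p = real n - real p * real k"
    using p_pos by (simp add: left_diff_distrib)
  ultimately have "(real n / real p - real k) * real p \<le> (real p - 1) * real c" by linarith
  hence "real n / real p - real k \<le> (real p - 1) * real c / real p"
    using p_pos by (simp add: pos_le_divide_eq)
  \<comment> \<open>Multiplying by \<open>p\<close> instead of dividing gives away a factor
    \<open>p\<close> squared and yields the stated form.\<close>
  also have "\<dots> \<le> (real p - 1) * real c * real p"
  proof -
    have "0 \<le> (real p - 1) * real c" using p_ge2 by simp
    moreover have "1 / real p \<le> real p" using p_ge2 by (simp add: field_simps) (simp add: mult_ge1_I)
    ultimately show ?thesis using mult_left_mono[of "1 / real p" "real p"] by fastforce
  qed
  finally have "real n / real p - real k \<le> real c * (real p * (real p - 1))"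
    by (simp add: mult.commute mult.left_commute)
  thus ?thesis unfolding c_def[symmetric] using p_ge2 by (subst pos_divide_le_eq) auto
qed

end
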